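(* The map $$\Xi:\Lambda_A\to\mathbb{S}_A,\qquad\Xi(x)=(x,\sigma(x)),$$ is well defined and gives an embedding $\Lambda_A\hookrightarrow\mathbb{S}_A$ (i.e. it is injective and continuous).
   Context: Let $A=(A_{ij})_{i,j=0,\dots,N-1}$ be a matrix with entries in $\{0,1\}$ with $A_{ii}=1$ for all $i$. $\Lambda_A$ is the set of sequences $x=(x_1x_2x_3\dots)$, $x_i\in\{0,\dots,N-1\}$, with $A_{x_ix_{i+1}}=1$ for all $i\ge1$ (identified with numbers $0.x_1x_2\dots$ in $N$-adic expansion), with the Cantor topology in which the sets $\Lambda_A(i_1,\dots,i_k)$ of sequences with given first $k$ digits form a basis of clopen sets. $\sigma(x_1x_2x_3\dots)=(x_2x_3\dots)$ is the shift on $\Lambda_A$. $\mathbb{S}_A$ is the set of pairs $(x,y)$ with $x=0.x_1x_2\cdots$, $y=0.y_1y_2\cdots$ in $N$-adic expansion, digits in $\{0,\dots,N-1\}$, and $A_{x_i,y_i}=1$ for all $i\ge1$; points are described by their pairs of digit sequences and the topology has as a basis of clopen sets the sets $\mathbb{S}_A(i_1\cdots i_k,j_1\cdots j_k)$ of pairs with given first $k$ digits. *)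

theory Defs
  imports "HOL-Analysis.Analysis"
begin

text \<open>
  Infinite words are functions on \<open>nat\<close>, so \<open>x n\<close> is the digit written \<open>x\<^sub>n\<^sub>+\<^sub>1\<close> on paper. The points of
  both spaces are (pairs of) digit sequences: two different expansions of the same real number are
  different points, as the Cantor topology requires.
\<close>

definition Lambda_set :: "nat \<Rightarrow> (nat \<Rightarrow> nat \<Rightarrow> nat) \<Rightarrow> (nat \<Rightarrow> nat) set" where
  "Lambda_set N A = {x. (\<forall>n. x n \<in> {0..<N}) \<and> (\<forall>n. A (x n) (x (Suc n)) = 1)}"

definition S_set :: "nat \<Rightarrow> (nat \<Rightarrow> nat \<Rightarrow> nat) \<Rightarrow> ((nat \<Rightarrow> nat) \<times> (nat \<Rightarrow> nat)) set" where
  "S_set N A = {(x, y). (\<forall>n. x n \<in> {0..<N}) \<and> (\<forall>n. y n \<in> {0..<N}) \<and> (\<forall>n. A (x n) (y n) = 1)}"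

definition has_prefix :: "(nat \<Rightarrow> nat) \<Rightarrow> nat list \<Rightarrow> bool" where
  "has_prefix x w \<longleftrightarrow> (\<forall>i<length w. x i = w ! i)"

definition Lambda_cyl :: "nat \<Rightarrow> (nat \<Rightarrow> nat \<Rightarrow> nat) \<Rightarrow> nat list \<Rightarrow> (nat \<Rightarrow> nat) set" where
  "Lambda_cyl N A u = {x \<in> Lambda_set N A. has_prefix x u}"

definition S_cyl ::
    "nat \<Rightarrow> (nat \<Rightarrow> nat \<Rightarrow> nat) \<Rightarrow> nat list \<Rightarrow> nat list \<Rightarrow> ((nat \<Rightarrow> nat) \<times> (nat \<Rightarrow> nat)) set" where
  "S_cyl N A u v = {(x, y) \<in> S_set N A. has_prefix x u \<and> has_prefix y v}"

text \<open>
  Words that are not admissible give the empty cylinder, and the empty word gives the whole space.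
  The lemmas \<open>Lambda_top_base\<close> and \<open>S_top_base\<close> below show that the cylinders are a basis, not only
  a subbasis.
\<close>

definition Lambda_top :: "nat \<Rightarrow> (nat \<Rightarrow> nat \<Rightarrow> nat) \<Rightarrow> (nat \<Rightarrow> nat) topology" where
  "Lambda_top N A = topology_generated_by {Lambda_cyl N A u | u. True}"

definition S_top :: "nat \<Rightarrow> (nat \<Rightarrow> nat \<Rightarrow> nat) \<Rightarrow> ((nat \<Rightarrow> nat) \<times> (nat \<Rightarrow> nat)) topology" where
  "S_top N A = topology_generated_by {S_cyl N A u v | u v. length u = length v}"

definition shift :: "(nat \<Rightarrow> nat) \<Rightarrow> (nat \<Rightarrow> nat)" where
  "shift x = (\<lambda>n. x (Suc n))"

definition Xi :: "(nat \<Rightarrow> nat) \<Rightarrow> (nat \<Rightarrow> nat) \<times> (nat \<Rightarrow> nat)" where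
  "Xi x = (x, shift x)"

lemma topspace_Lambda_top [simp]: "topspace (Lambda_top N A) = Lambda_set N A"
proof -
  have "Lambda_cyl N A [] = Lambda_set N A"
    by (simp add: Lambda_cyl_def has_prefix_def)
  then show ?thesis
    unfolding Lambda_top_def topology_generated_by_topspace
    by (auto simp: Lambda_cyl_def)
qed

lemma topspace_S_top [simp]: "topspace (S_top N A) = S_set N A"
proof -
  have "S_cyl N A [] [] = S_set N A"
    by (auto simp: S_cyl_def has_prefix_def)
  then show ?thesis
    unfolding S_top_def topology_generated_by_topspace
    by (fastforce simp: S_cyl_def)
qed

lemma has_prefix_mono:
  assumes "has_prefix x u" "has_prefix x v" "length u \<le> length v" "has_prefix z v"
  shows "has_prefix z u"
  using assms by (auto simp: has_prefix_def)

lemma Lambda_top_base: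
  "openin (Lambda_top N A) U \<longleftrightarrow>
    U \<subseteq> Lambda_set N A \<and> (\<forall>x\<in>U. \<exists>u. x \<in> Lambda_cyl N A u \<and> Lambda_cyl N A u \<subseteq> U)"
proof -
  have *: "\<forall>x\<in>U. \<exists>u. x \<in> Lambda_cyl N A u \<and> Lambda_cyl N A u \<subseteq> U"
    if "generate_topology_on {Lambda_cyl N A u | u. True} U" for U
    using that
  proof (induction rule: generate_topology_on.induct)
    case (Int a b)
    show ?case
    proof
      fix x assume "x \<in> a \<inter> b"
      then obtain u v where uv: "x \<in> Lambda_cyl N A u" "Lambda_cyl N A u \<subseteq> a"
          "x \<in> Lambda_cyl N A v" "Lambda_cyl N A v \<subseteq> b"
        using Int.IH by blast
      show "\<exists>w. x \<in> Lambda_cyl N A w \<and> Lambda_cyl N A w \<subseteq> a \<inter> b"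
      proof (cases "length u \<le> length v")
        case True
        then have "Lambda_cyl N A v \<subseteq> Lambda_cyl N A u"
          using uv has_prefix_mono[of x u v] by (auto simp: Lambda_cyl_def)
        then show ?thesis using uv by blast
      next
        case False
        then have "Lambda_cyl N A u \<subseteq> Lambda_cyl N A v"
          using uv has_prefix_mono[of x v u] by (auto simp: Lambda_cyl_def)
        then show ?thesis using uv by blast
      qed
    qed
  next
    case (UN K)
    then show ?case by blast
  qed auto
  show ?thesis (is "?L = ?R")
  proof
    assume ?L
    then have "U \<subseteq> Lambda_set N A"
      using openin_subset[of "Lambda_top N A" U] by simp
    with \<open>?L\<close> show ?R
      using *[OF openin_topology_generated_by[OF \<open>?L\<close>[unfolded Lambda_top_def]]] by (rule_tac conjI)
  next
    assume R: ?R
    have "openin (Lambda_top N A) (Lambda_cyl N A u)" for u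
      unfolding Lambda_top_def by (rule topology_generated_by_Basis) blast
    then show ?L
      using R by (subst openin_subopen) blast
  qed
qed

lemma S_top_base:
  "openin (S_top N A) U \<longleftrightarrow>
    U \<subseteq> S_set N A \<and>
    (\<forall>p\<in>U. \<exists>u v. length u = length v \<and> p \<in> S_cyl N A u v \<and> S_cyl N A u v \<subseteq> U)"
proof -
  have *: "\<forall>p\<in>U. \<exists>u v. length u = length v \<and> p \<in> S_cyl N A u v \<and> S_cyl N A u v \<subseteq> U"
    if "generate_topology_on {S_cyl N A u v | u v. length u = length v} U" for U
    using that
  proof (induction rule: generate_topology_on.induct)
    case (Int a b)
    show ?case
    proof
      fix p assume "p \<in> a \<inter> b"
      then obtain u v u' v' where uv: "length u = length v" "p \<in> S_cyl N A u v"
          "S_cyl N A u v \<subseteq> a" "length u' = length v'" "p \<in> S_cyl N A u' v'" "S_cyl N A u' v' \<subseteq> b"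
        using Int.IH by blast
      show "\<exists>w z. length w = length z \<and> p \<in> S_cyl N A w z \<and> S_cyl N A w z \<subseteq> a \<inter> b"
      proof (cases "length u \<le> length u'")
        case True
        then have "S_cyl N A u' v' \<subseteq> S_cyl N A u v"
          using uv has_prefix_mono[of "fst p" u u'] has_prefix_mono[of "snd p" v v']
          by (auto simp: S_cyl_def)
        then show ?thesis using uv by blast
      next
        case False
        then have "S_cyl N A u v \<subseteq> S_cyl N A u' v'"
          using uv has_prefix_mono[of "fst p" u' u] has_prefix_mono[of "snd p" v' v]
          by (auto simp: S_cyl_def)
        then show ?thesis using uv by blast
      qed
    qed
  next
    case (UN K)
    then show ?case by blast
  qed auto
  show ?thesis (is "?L = ?R")
  proof
    assume ?L
    then have "U \<subseteq> S_set N A"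
      using openin_subset[of "S_top N A" U] by simp
    with \<open>?L\<close> show ?R
      using *[OF openin_topology_generated_by[OF \<open>?L\<close>[unfolded S_top_def]]] by (rule_tac conjI)
  next
    assume R: ?R
    have "openin (S_top N A) (S_cyl N A u v)" if "length u = length v" for u v
      unfolding S_top_def by (rule topology_generated_by_Basis) (use that in blast)
    then show ?L
      using R by (subst openin_subopen) blast
  qed
qed

end

theory Submission
  imports Defs
begin

text \<open>
  The \<open>n\<close>-th digit pair of \<open>(x, \<sigma>(x))\<close> is \<open>(x\<^sub>n, x\<^sub>n\<^sub>+\<^sub>1)\<close>, so the condition defining \<open>\<Lambda>\<^sub>A\<close> is
  exactly the one that puts \<open>\<Xi>(x)\<close> into \<open>S\<^sub>A\<close>; injectivity is read off the first coordinate.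
  For continuity, the first \<open>k\<close> digit pairs of \<open>\<Xi>(x)\<close> depend only on the first \<open>k + 1\<close> digits
  of \<open>x\<close>, so the preimage of a cylinder is a union of cylinders (\<open>openin_Xi_vimage_S_cyl\<close>).
\<close>

lemma Xi_in_S_set: "x \<in> Lambda_set N A \<Longrightarrow> Xi x \<in> S_set N A"
  by (auto simp: Xi_def shift_def Lambda_set_def S_set_def)

lemma inj_Xi: "inj Xi"
  by (auto simp: Xi_def inj_on_def)

lemma openin_Xi_vimage_S_cyl:
  assumes "length u = length v"
  shows "openin (Lambda_top N A) (Xi -` S_cyl N A u v \<inter> Lambda_set N A)"
  unfolding Lambda_top_base
proof (intro conjI ballI)
  fix x assume x: "x \<in> Xi -` S_cyl N A u v \<inter> Lambda_set N A"
  \<comment> \<open>One digit more than \<open>u\<close> has, since \<open>shift x\<close> reads one digit further than \<open>x\<close>.\<close>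
  define w where "w = map x [0..<Suc (length u)]"
  have prefix_w: "has_prefix z w \<longleftrightarrow> (\<forall>i\<le>length u. z i = x i)" for z
    by (auto simp: has_prefix_def w_def less_Suc_eq_le simp del: upt_Suc)
  have "x \<in> Lambda_cyl N A w"
    using x by (simp add: Lambda_cyl_def prefix_w)
  moreover have "Lambda_cyl N A w \<subseteq> Xi -` S_cyl N A u v \<inter> Lambda_set N A"
  proof
    fix z assume "z \<in> Lambda_cyl N A w"
    then have z: "z \<in> Lambda_set N A" and eq: "\<And>i. i \<le> length u \<Longrightarrow> z i = x i"
      by (auto simp: Lambda_cyl_def prefix_w)
    have "has_prefix x u" "has_prefix (shift x) v"
      using x by (auto simp: S_cyl_def Xi_def)
    then have "has_prefix z u" "has_prefix (shift z) v"
      using eq assms by (auto simp: has_prefix_def shift_def)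
    then show "z \<in> Xi -` S_cyl N A u v \<inter> Lambda_set N A"
      using z Xi_in_S_set[OF z] by (simp add: S_cyl_def Xi_def)
  qed
  ultimately show "\<exists>w. x \<in> Lambda_cyl N A w \<and>
      Lambda_cyl N A w \<subseteq> Xi -` S_cyl N A u v \<inter> Lambda_set N A"
    by blast
qed auto

lemma continuous_map_Xi: "continuous_map (Lambda_top N A) (S_top N A) Xi"
proof -
  have "Xi ` Lambda_set N A \<subseteq> topspace (S_top N A)"
    using Xi_in_S_set by auto
  then show ?thesis
    unfolding S_top_def topology_generated_by_topspace
    by (intro continuous_on_generated_topo) (auto intro: openin_Xi_vimage_S_cyl)
qed

theorem lemma2p24:
  fixes N :: nat and A :: "nat \<Rightarrow> nat \<Rightarrow> nat"
  assumes "\<And>i j. i < N \<Longrightarrow> j < N \<Longrightarrow> A i j \<in> {0, 1}"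
    and "\<And>i. i < N \<Longrightarrow> A i i = 1"
  shows "Xi \<in> Lambda_set N A \<rightarrow> S_set N A \<and>
         inj_on Xi (Lambda_set N A) \<and>
         continuous_map (Lambda_top N A) (S_top N A) Xi"
  using Xi_in_S_set inj_on_subset[OF inj_Xi subset_UNIV] continuous_map_Xi by blast

end
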